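(* Let $\mathcal{L}$ be a finite relational language and $\mathcal{T}$ a finite set of finite $\mathcal{L}$-structures. Let $C$ be a finite $\mathcal{T}$-free $\mathcal{L}$-structure, with a fixed natural factorization $\{(C_i,a_i): i=1,\dots,n\}$, and let $(D,\phi)$ be a finite $\mathcal{T}$-free, minimal HL-extension of $C$. Then there are normal subgroups $N_1,\dots,N_n\unlhd\mathbb{F}(\mathcal{P}_C)$ of finite index such that $(\Gamma_{\vec N},\Phi_{\vec N})$ is a finite $\mathcal{T}$-free, minimal HL-extension of $C$ and there is a homomorphism from $(\Gamma_{\vec N},\Phi_{\vec N})$ onto $(D,\phi)$.
   Context: Basic notions. A homomorphism $h:M\to N$ of $\mathcal{L}$-structures is a map such that $R^M(b_1,\dots,b_m)$ implies $R^N(h(b_1),\dots,h(b_m))$ for every $m$-ary $R\in\mathcal{L}$. $M$ is $\mathcal{T}$-free if no $T\in\mathcal{T}$ admits a homomorphism $T\to M$. $D$ is an extension of $C$ if $C$ is a substructure of $D$; the same terminology is used when $D$ contains an isomorphic copy of $C$. HL-extensions. A partial isomorphism of $C$ is an isomorphism between two finite substructures of $C$. $\mathcal{P}_C$ is the set of partial isomorphisms of $C$ that are not restrictions of the identity $1_C$. An HL-extension of $C$ is a pair $(D,\phi)$ where $D$ is an extension of $C$ and $\phi:\mathcal{P}_C\to\mathrm{Aut}(D)$ is such that $\phi(p)$ extends $p$ for all $p\in\mathcal{P}_C$; it is tacitly assumed that $\phi(p^{-1})=\phi(p)^{-1}$. It is finite ($\mathcal{T}$-free) if $D$ is. It is minimal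 if for every $b\in D\setminus C$ there are $p_1,\dots,p_k\in\mathcal{P}_C$ and $a\in C$ with $b=\phi(p_1)\cdots\phi(p_k)(a)$. A homomorphism from an HL-extension $(D_1,\phi_1)$ of $C$ to an HL-extension $(D_2,\phi_2)$ of $C$ is a homomorphism of structures $\psi:D_1\to D_2$ that is the identity on $C$ and satisfies $\psi\circ\phi_1(p)=\phi_2(p)\circ\psi$ for all $p\in\mathcal{P}_C$. Natural factorization. There is a unique partition of $C$ into substructures $C_1,\dots,C_n$ such that each $C_i$ is a maximal subset of $C$ with the property that for all $a,b\in C_i$ the map $\{(a,b)\}$ is a partial isomorphism of $C$. A natural factorization of $C$ is this partition together with a chosen point $a_i\in C_i$ for each $i$, written $\{(C_i,a_i):i=1,\dots,n\}$. Groups. $\mathbb{F}(\mathcal{P}_C)$ is the free group with generating set $\mathcal{P}_C$, with the convention that the inverse of $p\in\mathcal{P}_C$ in $\mathbb{F}(\mathcal{P}_C)$ coincides with $p^{-1}$. For each $i$, $H_i=\{g\in\mathbb{F}(\mathcal{P}_C): g(a_i)=a_i\}$, where $g(a_i)=a_i$ means that if $g=p_1\cdots p_m$ with $p_1,\dots,p_m\in\mathcal{P}_C$, then $p_1(\cdots(p_m(a_i))\cdots)$ is defined and equals $a_i$. Each $H_i$ is a subgroup of $\mathbb{F}(\mathcal{P}_C)$. The pair $(\Gamma_{\vec N},\Phi_{\vec N})$. For normal subgroups $N_1,\dots,N_n\unlhd\mathbb{F}(\mathcal{P}_C)$ of finite index, $\Gamma_{\vec N}$ is the $\mathcal{L}$-structure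 with domain the disjoint union $\mathbb{F}(\mathcal{P}_C)/N_1H_1\sqcup\cdots\sqcup\mathbb{F}(\mathcal{P}_C)/N_nH_n$ of sets of left cosets. For an $m$-ary $R\in\mathcal{L}$, $R^{\Gamma_{\vec N}}(g_1N_{i_1}H_{i_1},\dots,g_mN_{i_m}H_{i_m})$ holds iff there are $p_1,\dots,p_m\in\mathcal{P}_C$ and $g\in\mathbb{F}(\mathcal{P}_C)$ such that $p_j(a_{i_j})$ is defined for each $j=1,\dots,m$, $(g_1N_{i_1}H_{i_1},\dots,g_mN_{i_m}H_{i_m})=(gp_1N_{i_1}H_{i_1},\dots,gp_mN_{i_m}H_{i_m})$, and $R^C(p_1(a_{i_1}),\dots,p_m(a_{i_m}))$. The map $\pi_{\vec N}:C\to\Gamma_{\vec N}$ is given, for $a\in C_i$, by $\pi_{\vec N}(a)=N_iH_i$ if $a=a_i$, and $\pi_{\vec N}(a)=pN_iH_i$ if $a\ne a_i$ and $p\in\mathcal{P}_C$ satisfies $p(a_i)=a$. When $\pi_{\vec N}$ is an isomorphic embedding, $\Gamma_{\vec N}$ is regarded as an extension of $C$ via $\pi_{\vec N}$; this is the sense in which $(\Gamma_{\vec N},\Phi_{\vec N})$ is an HL-extension of $C$. The map $\Phi_{\vec N}:\mathcal{P}_C\to\mathrm{Aut}(\Gamma_{\vec N})$ is defined by $\Phi_{\vec N}(p)(gN_iH_i)=pgN_iH_i$.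
   Formalization: In the definition of R^Γ the p_j range over all partial isomorphisms of C, restrictions of the identity acting as the unit of F(P_C), not only over P_C; read literally the claim fails for C a single point with a unary relation holding. *)

theory Defs
  imports "HOL-Algebra.Coset" "HOL-Library.Disjoint_Sets"
begin

section \<open>Relational structures\<close>

record 'r language =
  symbols :: "'r set"
  arity :: "'r \<Rightarrow> nat"

record ('r, 'a) rel_struct =
  universe :: "'a set"
  rel :: "'r \<Rightarrow> 'a list set"

definition is_structure :: "'r language \<Rightarrow> ('r, 'a) rel_struct \<Rightarrow> bool" where
  "is_structure L M \<longleftrightarrow>
     (\<forall>R\<in>symbols L. \<forall>xs\<in>rel M R. length xs = arity L R \<and> set xs \<subseteq> universe M)"

definition substruct :: "('r, 'a) rel_struct \<Rightarrow> 'a set \<Rightarrow> ('r, 'a) rel_struct" where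
  "substruct M A = \<lparr> universe = A, rel = (\<lambda>R. {xs \<in> rel M R. set xs \<subseteq> A}) \<rparr>"

definition is_hom ::
  "'r language \<Rightarrow> ('r, 'a) rel_struct \<Rightarrow> ('r, 'b) rel_struct \<Rightarrow> ('a \<Rightarrow> 'b) \<Rightarrow> bool" where
  "is_hom L M N h \<longleftrightarrow>
     h ` universe M \<subseteq> universe N \<and> (\<forall>R\<in>symbols L. \<forall>xs\<in>rel M R. map h xs \<in> rel N R)"

definition is_embedding ::
  "'r language \<Rightarrow> ('r, 'a) rel_struct \<Rightarrow> ('r, 'b) rel_struct \<Rightarrow> ('a \<Rightarrow> 'b) \<Rightarrow> bool" where
  "is_embedding L M N h \<longleftrightarrow>
     inj_on h (universe M) \<and> h ` universe M \<subseteq> universe N \<and>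
     (\<forall>R\<in>symbols L. \<forall>xs. length xs = arity L R \<and> set xs \<subseteq> universe M \<longrightarrow>
        (xs \<in> rel M R \<longleftrightarrow> map h xs \<in> rel N R))"

definition is_iso ::
  "'r language \<Rightarrow> ('r, 'a) rel_struct \<Rightarrow> ('r, 'b) rel_struct \<Rightarrow> ('a \<Rightarrow> 'b) \<Rightarrow> bool" where
  "is_iso L M N h \<longleftrightarrow> is_embedding L M N h \<and> h ` universe M = universe N"

abbreviation is_automorphism ::
  "'r language \<Rightarrow> ('r, 'a) rel_struct \<Rightarrow> ('a \<Rightarrow> 'a) \<Rightarrow> bool" where
  "is_automorphism L M h \<equiv> is_iso L M M h"

definition free_of ::
  "'r language \<Rightarrow> ('r, 't) rel_struct set \<Rightarrow> ('r, 'a) rel_struct \<Rightarrow> bool" where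
  "free_of L \<T> M \<longleftrightarrow> \<not> (\<exists>T\<in>\<T>. \<exists>h. is_hom L T M h)"


section \<open>Partial isomorphisms\<close>

text \<open>Partial maps are represented by their graphs, so that the inverse of \<open>p\<close> is the
  converse relation \<open>p\<inverse>\<close>, and the restrictions of the identity are the subsets of \<^term>\<open>Id\<close>.\<close>

type_synonym 'c pmap = "('c \<times> 'c) set"

definition partial_isos :: "'r language \<Rightarrow> ('r, 'c) rel_struct \<Rightarrow> 'c pmap set" where
  "partial_isos L C =
     {{(x, f x) | x. x \<in> A} | A B f.
        finite A \<and> finite B \<and> A \<subseteq> universe C \<and> B \<subseteq> universe C \<and>
        is_iso L (substruct C A) (substruct C B) f}"

definition proper_isos :: "'r language \<Rightarrow> ('r, 'c) rel_struct \<Rightarrow> 'c pmap set" where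
  "proper_isos L C = {p \<in> partial_isos L C. \<not> p \<subseteq> Id}"


section \<open>HL-extensions\<close>

text \<open>\<open>D\<close> is an extension of \<open>C\<close> via an embedding \<open>e\<close> of \<open>C\<close> into \<open>D\<close>; the case of a
  substructure is the one where \<open>e\<close> is the identity. Maps into the automorphism group of \<open>D\<close>
  are functions whose values matter only on \<^term>\<open>universe D\<close>.\<close>

definition HL_extension ::
  "'r language \<Rightarrow> ('r, 'c) rel_struct \<Rightarrow> ('r, 'd) rel_struct \<Rightarrow> ('c \<Rightarrow> 'd) \<Rightarrow>
     ('c pmap \<Rightarrow> 'd \<Rightarrow> 'd) \<Rightarrow> bool" where
  "HL_extension L C D e \<phi> \<longleftrightarrow>
     is_structure L D \<and> is_embedding L C D e \<and>
     (\<forall>p\<in>proper_isos L C.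
        is_automorphism L D (\<phi> p) \<and>
        (\<forall>(x, y)\<in>p. \<phi> p (e x) = e y) \<and>
        (\<forall>d\<in>universe D. \<phi> (p\<inverse>) d = inv_into (universe D) (\<phi> p) d))"

definition HL_minimal ::
  "'r language \<Rightarrow> ('r, 'c) rel_struct \<Rightarrow> ('r, 'd) rel_struct \<Rightarrow> ('c \<Rightarrow> 'd) \<Rightarrow>
     ('c pmap \<Rightarrow> 'd \<Rightarrow> 'd) \<Rightarrow> bool" where
  "HL_minimal L C D e \<phi> \<longleftrightarrow>
     (\<forall>b \<in> universe D - e ` universe C.
        \<exists>ps c. set ps \<subseteq> proper_isos L C \<and> c \<in> universe C \<and> b = foldr \<phi> ps (e c))"

definition HL_hom ::
  "'r language \<Rightarrow> ('r, 'c) rel_struct \<Rightarrow>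
     ('r, 'd1) rel_struct \<Rightarrow> ('c \<Rightarrow> 'd1) \<Rightarrow> ('c pmap \<Rightarrow> 'd1 \<Rightarrow> 'd1) \<Rightarrow>
     ('r, 'd2) rel_struct \<Rightarrow> ('c \<Rightarrow> 'd2) \<Rightarrow> ('c pmap \<Rightarrow> 'd2 \<Rightarrow> 'd2) \<Rightarrow>
     ('d1 \<Rightarrow> 'd2) \<Rightarrow> bool" where
  "HL_hom L C D1 e1 \<phi>1 D2 e2 \<phi>2 \<psi> \<longleftrightarrow>
     is_hom L D1 D2 \<psi> \<and>
     (\<forall>c\<in>universe C. \<psi> (e1 c) = e2 c) \<and>
     (\<forall>p\<in>proper_isos L C. \<forall>d\<in>universe D1. \<psi> (\<phi>1 p d) = \<phi>2 p (\<psi> d))"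


section \<open>Natural factorizations\<close>

definition pointwise_isomorphic ::
  "'r language \<Rightarrow> ('r, 'c) rel_struct \<Rightarrow> 'c set \<Rightarrow> bool" where
  "pointwise_isomorphic L C A \<longleftrightarrow>
     A \<subseteq> universe C \<and> (\<forall>x\<in>A. \<forall>y\<in>A. {(x, y)} \<in> partial_isos L C)"

definition natural_factorization ::
  "'r language \<Rightarrow> ('r, 'c) rel_struct \<Rightarrow> nat \<Rightarrow> (nat \<Rightarrow> 'c set) \<Rightarrow> (nat \<Rightarrow> 'c) \<Rightarrow> bool" where
  "natural_factorization L C n Cs a \<longleftrightarrow>
     disjoint_family_on Cs {1..n} \<and> (\<Union>i\<in>{1..n}. Cs i) = universe C \<and>
     (\<forall>i\<in>{1..n}. a i \<in> Cs i \<and> pointwise_isomorphic L C (Cs i) \<and>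
        (\<forall>B. pointwise_isomorphic L C B \<and> Cs i \<subseteq> B \<longrightarrow> B = Cs i))"


section \<open>The group generated by the partial isomorphisms\<close>

text \<open>The free group on \<open>P\<close> in which the inverse of a generator \<open>p\<close> is the generator \<open>p\<inverse>\<close>,
  realized on reduced words: no letter is followed by its converse. (So a generator with
  \<open>p\<inverse> = p\<close> is an involution of the group.) The word \<open>[p\<^sub>1, \<dots>, p\<^sub>m]\<close> stands for the product
  \<open>p\<^sub>1 \<cdots> p\<^sub>m\<close>.\<close>

fun reduced :: "'c pmap list \<Rightarrow> bool" where
  "reduced (p # q # w) \<longleftrightarrow> q \<noteq> p\<inverse> \<and> reduced (q # w)"
| "reduced _ \<longleftrightarrow> True"

fun push :: "'c pmap \<Rightarrow> 'c pmap list \<Rightarrow> 'c pmap list" where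
  "push p (q # w) = (if q = p\<inverse> then w else p # q # w)"
| "push p [] = [p]"

definition free_group :: "'c pmap set \<Rightarrow> 'c pmap list monoid" where
  "free_group P = \<lparr> carrier = {w. set w \<subseteq> P \<and> reduced w}, mult = foldr push, one = [] \<rparr>"

text \<open>The element of the free group denoted by a partial isomorphism; restrictions of the
  identity are not generators and denote the unit.\<close>

definition letter :: "'c pmap \<Rightarrow> 'c pmap list" where
  "letter p = (if p \<subseteq> Id then [] else [p])"

text \<open>The graph of the partial map \<open>x \<mapsto> p\<^sub>1 (\<dots> (p\<^sub>m x))\<close>.\<close>

fun word_graph :: "'c pmap list \<Rightarrow> 'c pmap" where
  "word_graph [] = Id"
| "word_graph (p # w) = word_graph w O p"

text \<open>The condition \<open>g(c) = c\<close> is read off the reduced word of \<open>g\<close>. This is the same as asking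
  for some word representing \<open>g\<close>, since cancelling \<open>p p\<inverse>\<close> can only enlarge the partial map.\<close>

definition fix_subgroup :: "'c pmap set \<Rightarrow> 'c \<Rightarrow> 'c pmap list set" where
  "fix_subgroup P c = {g \<in> carrier (free_group P). (c, c) \<in> word_graph g}"

lemma push_reduced: "reduced w \<Longrightarrow> reduced (push p w)"
  by (cases w rule: reduced.cases) auto

lemma push_set: "set (push p w) \<subseteq> insert p (set w)"
  by (cases w) auto

lemma push_push_converse: "reduced w \<Longrightarrow> push p (push (p\<inverse>) w) = w"
  by (cases w rule: reduced.cases) auto

lemma foldr_push_reduced: "reduced v \<Longrightarrow> reduced (foldr push u v)"
  by (induction u) (auto simp: push_reduced)

lemma foldr_push_set: "set (foldr push u v) \<subseteq> set u \<union> set v"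
proof (induction u)
  case (Cons p u)
  then show ?case using push_set[of p "foldr push u v"] by auto
qed simp

lemma foldr_push_push:
  assumes "reduced v" "reduced w"
  shows "foldr push (push p v) w = push p (foldr push v w)"
proof (cases v)
  case (Cons q v')
  then show ?thesis
    using push_push_converse[OF foldr_push_reduced[OF assms(2)], of p v'] by auto
qed simp

lemma foldr_push_assoc:
  assumes "reduced v" "reduced w"
  shows "foldr push (foldr push u v) w = foldr push u (foldr push v w)"
  by (induction u) (simp_all add: assms foldr_push_push foldr_push_reduced)

lemma foldr_push_Nil: "reduced u \<Longrightarrow> foldr push u [] = u"
  by (induction u rule: reduced.induct) auto

lemma foldr_push_inverse:
  "reduced v \<Longrightarrow> foldr push (rev (map converse u)) (foldr push u v) = v"
proof (induction u arbitrary: v)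
  case (Cons p u)
  then show ?case
    using push_push_converse[OF foldr_push_reduced[OF Cons.prems], of "p\<inverse>" u] by simp
qed simp

lemma group_free_group:
  assumes "\<And>p. p \<in> P \<Longrightarrow> p\<inverse> \<in> P"
  shows "group (free_group P)"
proof (rule groupI)
  fix u assume u: "u \<in> carrier (free_group P)"
  let ?v = "foldr push (rev (map converse u)) []"
  have "set ?v \<subseteq> P"
    using u assms foldr_push_set[of "rev (map converse u)" "[]"] by (auto simp: free_group_def)
  then have "?v \<in> carrier (free_group P)"
    by (simp add: free_group_def foldr_push_reduced)
  moreover have "?v \<otimes>\<^bsub>free_group P\<^esub> u = \<one>\<^bsub>free_group P\<^esub>"
    using u foldr_push_assoc[of "[]" u "rev (map converse u)"]
      foldr_push_inverse[of "[]" u]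
    by (simp add: free_group_def foldr_push_Nil)
  ultimately show "\<exists>v\<in>carrier (free_group P). v \<otimes>\<^bsub>free_group P\<^esub> u = \<one>\<^bsub>free_group P\<^esub>"
    by blast
next
  fix u v assume "u \<in> carrier (free_group P)" "v \<in> carrier (free_group P)"
  then show "u \<otimes>\<^bsub>free_group P\<^esub> v \<in> carrier (free_group P)"
    using foldr_push_set[of u v] by (auto simp: free_group_def foldr_push_reduced)
qed (auto simp: free_group_def foldr_push_assoc)


section \<open>The HL-extension given by a tuple of normal subgroups\<close>

text \<open>Throughout, \<open>\<F>\<close> is the free group on the proper partial isomorphisms of \<open>C\<close>.
  The block with index \<open>i\<close> of the disjoint union consists of the pairs \<open>(i, K)\<close>, where \<open>K\<close> is a
  left coset of \<open>N\<^sub>i H\<^sub>i\<close>.\<close>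

abbreviation pgroup :: "'r language \<Rightarrow> ('r, 'c) rel_struct \<Rightarrow> 'c pmap list monoid" (\<open>\<F>\<close>) where
  "\<F> L C \<equiv> free_group (proper_isos L C)"

definition NH ::
  "'r language \<Rightarrow> ('r, 'c) rel_struct \<Rightarrow> (nat \<Rightarrow> 'c) \<Rightarrow> (nat \<Rightarrow> 'c pmap list set) \<Rightarrow>
     nat \<Rightarrow> 'c pmap list set" where
  "NH L C a N i = N i <#>\<^bsub>\<F> L C\<^esub> fix_subgroup (proper_isos L C) (a i)"

text \<open>In the definition of the relations, each list entry \<open>(i, p, b)\<close> records an index \<open>i\<close>, a
  partial isomorphism \<open>p\<close> and the value \<open>b = p(a\<^sub>i)\<close>. The \<open>p\<close> range over all partial isomorphisms,
  restrictions of the identity denoting the unit of the group. Proper ones do not suffice: if no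
  proper partial isomorphism is defined at \<open>a\<^sub>i\<close>, as happens when \<open>C\<close> is a single point,
  then no relation would ever hold in the block with index \<open>i\<close>, and \<open>C\<close> would not embed.\<close>

definition Gamma ::
  "'r language \<Rightarrow> ('r, 'c) rel_struct \<Rightarrow> nat \<Rightarrow> (nat \<Rightarrow> 'c) \<Rightarrow> (nat \<Rightarrow> 'c pmap list set) \<Rightarrow>
     ('r, nat \<times> 'c pmap list set) rel_struct" where
  "Gamma L C n a N =
     \<lparr> universe = {(i, g <#\<^bsub>\<F> L C\<^esub> NH L C a N i) | i g. i \<in> {1..n} \<and> g \<in> carrier (\<F> L C)},
       rel = (\<lambda>R.
         {map (\<lambda>(i, p, b). (i, (g \<otimes>\<^bsub>\<F> L C\<^esub> letter p) <#\<^bsub>\<F> L C\<^esub> NH L C a N i)) ts | g ts.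
            g \<in> carrier (\<F> L C) \<and> length ts = arity L R \<and>
            (\<forall>(i, p, b)\<in>set ts. i \<in> {1..n} \<and> p \<in> partial_isos L C \<and> (a i, b) \<in> p) \<and>
            map (\<lambda>(i, p, b). b) ts \<in> rel C R}) \<rparr>"

text \<open>The coset below does not depend on the choice of \<open>p\<close>: if also \<open>q(a\<^sub>i) = c\<close>, then
  \<open>q\<inverse> p\<close> lies in \<open>H\<^sub>i\<close>.\<close>

definition Gamma_embed ::
  "'r language \<Rightarrow> ('r, 'c) rel_struct \<Rightarrow> nat \<Rightarrow> (nat \<Rightarrow> 'c set) \<Rightarrow> (nat \<Rightarrow> 'c) \<Rightarrow>
     (nat \<Rightarrow> 'c pmap list set) \<Rightarrow> 'c \<Rightarrow> nat \<times> 'c pmap list set" where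
  "Gamma_embed L C n Cs a N c =
     (let i = (THE i. i \<in> {1..n} \<and> c \<in> Cs i) in
      (i, if c = a i then NH L C a N i
          else letter (SOME p. p \<in> proper_isos L C \<and> (a i, c) \<in> p) <#\<^bsub>\<F> L C\<^esub> NH L C a N i))"

definition Phi ::
  "'r language \<Rightarrow> ('r, 'c) rel_struct \<Rightarrow> 'c pmap \<Rightarrow>
     nat \<times> 'c pmap list set \<Rightarrow> nat \<times> 'c pmap list set" where
  "Phi L C p = (\<lambda>(i, K). (i, letter p <#\<^bsub>\<F> L C\<^esub> K))"

end

theory Submission
  imports Defs "HOL-Algebra.Bij" "HOL-Algebra.Zassenhaus"
begin

text \<open>Let \<open>\<F>\<close> act on \<open>D\<close> through \<open>\<phi>\<close>. As \<open>D\<close> is finite, the kernel of this action has finite index, and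
  every \<open>N\<^sub>i\<close> can be taken to be this kernel. Both the kernel and \<open>H\<^sub>i\<close> fix \<open>a\<^sub>i\<close> as a point of \<open>D\<close>, so
  \<open>\<psi>(g N\<^sub>i H\<^sub>i) = g(a\<^sub>i)\<close> is well defined; it is an \<open>\<F>\<close>-equivariant homomorphism of structures whose
  composition with \<open>\<pi>\<close> is the inclusion of \<open>C\<close> in \<open>D\<close>. Hence \<open>\<pi>\<close> is an embedding, and a homomorphism
  from some \<open>T \<in> \<T>\<close> to \<open>\<Gamma>\<close> would yield one to \<open>D\<close>. By minimality of \<open>D\<close>, \<open>\<psi>\<close> is onto.\<close>

section \<open>Partial isomorphisms\<close>

text \<open>Domain, range and map can all be recovered from the graph, and a tuple together with its
  image is a single list \<open>ts\<close> of pairs. In this form closure under converse and under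
  passing to subsets is immediate.\<close>

lemma partial_isos_iff:
  "p \<in> partial_isos L C \<longleftrightarrow>
     finite p \<and> p \<subseteq> universe C \<times> universe C \<and> single_valued p \<and> single_valued (p\<inverse>) \<and>
     (\<forall>R\<in>symbols L. \<forall>ts. length ts = arity L R \<and> set ts \<subseteq> p \<longrightarrow>
        (map fst ts \<in> rel C R \<longleftrightarrow> map snd ts \<in> rel C R))" (is "_ \<longleftrightarrow> ?r p")
proof
  assume "p \<in> partial_isos L C"
  then obtain A B f where p: "p = {(x, f x) | x. x \<in> A}" and A: "finite A" "A \<subseteq> universe C"
    and B: "B \<subseteq> universe C" and f: "is_iso L (substruct C A) (substruct C B) f"
    unfolding partial_isos_def by blast
  have pA: "p = (\<lambda>x. (x, f x)) ` A" using p by auto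
  have fA: "inj_on f A" "f ` A = B"
    using f by (auto simp: is_iso_def is_embedding_def substruct_def)
  have "map fst ts \<in> rel C R \<longleftrightarrow> map snd ts \<in> rel C R"
    if R: "R \<in> symbols L" and ts: "length ts = arity L R" "set ts \<subseteq> p" for R ts
  proof -
    have snd: "map snd ts = map f (map fst ts)" using ts(2) by (auto simp: p)
    have sub: "set (map fst ts) \<subseteq> A" using ts(2) by (auto simp: p)
    have sub': "set (map f (map fst ts)) \<subseteq> B" using sub fA by auto
    have "map fst ts \<in> rel (substruct C A) R \<longleftrightarrow> map f (map fst ts) \<in> rel (substruct C B) R"
      using f R ts sub unfolding is_iso_def is_embedding_def
      by (simp add: substruct_def del: map_map)
    then show ?thesis using sub sub' snd by (simp add: substruct_def del: map_map)
  qed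
  moreover have "single_valued p" "single_valued (p\<inverse>)"
    using fA by (auto simp: pA single_valued_def inj_on_def)
  moreover have "finite p" "p \<subseteq> universe C \<times> universe C" using A B fA by (auto simp: pA)
  ultimately show "?r p" by blast
next
  assume r: "?r p"
  define f where "f x = (THE y. (x, y) \<in> p)" for x
  have f: "f x = y" if "(x, y) \<in> p" for x y
    unfolding f_def using that r by (auto simp: single_valued_def)
  have graph: "(x, f x) \<in> p" if "x \<in> Domain p" for x using that f by blast
  then have p: "p = {(x, f x) | x. x \<in> Domain p}" using f by fastforce
  have "is_iso L (substruct C (Domain p)) (substruct C (Range p)) f"
    unfolding is_iso_def is_embedding_def
  proof (intro conjI ballI allI impI)
    show "inj_on f (universe (substruct C (Domain p)))"
      using r f by (fastforce simp: substruct_def inj_on_def single_valued_def)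
    show "f ` universe (substruct C (Domain p)) = universe (substruct C (Range p))"
      using f by (force simp: substruct_def)
    then show "f ` universe (substruct C (Domain p)) \<subseteq> universe (substruct C (Range p))" by simp
    fix R xs
    assume R: "R \<in> symbols L"
      and xs: "length xs = arity L R \<and> set xs \<subseteq> universe (substruct C (Domain p))"
    let ?ts = "map (\<lambda>x. (x, f x)) xs"
    have "set xs \<subseteq> Domain p" using xs by (simp add: substruct_def)
    then have "(x, f x) \<in> p" if "x \<in> set xs" for x using graph that by blast
    then have ts: "set ?ts \<subseteq> p" by auto
    moreover have "length ?ts = arity L R" using xs by simp
    ultimately have "map fst ?ts \<in> rel C R \<longleftrightarrow> map snd ?ts \<in> rel C R" using r R by blast
    moreover have "set (map f xs) \<subseteq> Range p" using ts by auto
    ultimately show "xs \<in> rel (substruct C (Domain p)) R \<longleftrightarrow>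
        map f xs \<in> rel (substruct C (Range p)) R"
      using xs by (simp add: substruct_def o_def)
  qed
  with r show "p \<in> partial_isos L C" unfolding partial_isos_def mem_Collect_eq
    by (intro exI[of _ "Domain p"] exI[of _ "Range p"] exI[of _ f] conjI)
      (rule p, auto simp: finite_Domain finite_Range)
qed

lemma partial_isos_converse:
  assumes "p \<in> partial_isos L C"
  shows "p\<inverse> \<in> partial_isos L C"
proof -
  have "map fst ts \<in> rel C R \<longleftrightarrow> map snd ts \<in> rel C R"
    if "R \<in> symbols L" "length ts = arity L R" "set ts \<subseteq> p\<inverse>" for R ts
  proof -
    have "set (map prod.swap ts) \<subseteq> p" "length (map prod.swap ts) = arity L R"
      using that by auto
    then have "map fst (map prod.swap ts) \<in> rel C R \<longleftrightarrow> map snd (map prod.swap ts) \<in> rel C R"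
      using assms that(1) unfolding partial_isos_iff by blast
    then show ?thesis by (simp add: o_def)
  qed
  then show ?thesis using assms unfolding partial_isos_iff by auto
qed

lemma partial_isos_mono:
  assumes "p \<in> partial_isos L C" "q \<subseteq> p"
  shows "q \<in> partial_isos L C"
  using assms unfolding partial_isos_iff
  by (meson converse_mono finite_subset order_trans single_valued_subset)

text \<open>A tuple over one point is constant, so only the relations on constant tuples are
  compared. Being related is thereby visibly an equivalence on points, which
  \<open>block_closed\<close> exploits.\<close>

lemma partial_isos_singleton_iff:
  "{(x, y)} \<in> partial_isos L C \<longleftrightarrow> x \<in> universe C \<and> y \<in> universe C \<and>
     (\<forall>R\<in>symbols L. replicate (arity L R) x \<in> rel C R \<longleftrightarrow> replicate (arity L R) y \<in> rel C R)"
proof -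
  have "(length ts = m \<and> set ts \<subseteq> {(x, y)}) \<longleftrightarrow> ts = replicate m (x, y)" for m ts
    by (auto simp: subset_iff intro: replicate_eqI)
  then show ?thesis unfolding partial_isos_iff by (auto simp: single_valued_def)
qed

lemma proper_isosD: "p \<in> proper_isos L C \<Longrightarrow> p \<in> partial_isos L C"
  by (simp add: proper_isos_def)

lemma proper_isos_converse: "p \<in> proper_isos L C \<Longrightarrow> p\<inverse> \<in> proper_isos L C"
  using partial_isos_converse by (fastforce simp: proper_isos_def)

lemma proper_isos_single_valued: "p \<in> proper_isos L C \<Longrightarrow> single_valued p"
  by (simp add: proper_isos_def partial_isos_iff)


section \<open>Point stabilizers in the free group\<close>

lemma word_graph_append: "word_graph (u @ v) = word_graph v O word_graph u"
  by (induction u) auto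

lemma word_graph_rev_converse: "word_graph (rev (map converse u)) = (word_graph u)\<inverse>"
  by (induction u) (auto simp: word_graph_append)

text \<open>Cancellation replaces \<open>p\<inverse> O p\<close>, a restriction of the identity
  because \<open>p\<close> is single-valued, by the full identity. Reduction can therefore enlarge
  the graph of a word, hence an inclusion and not an equality.\<close>

lemma word_graph_push: "single_valued p \<Longrightarrow> word_graph w O p \<subseteq> word_graph (push p w)"
  by (cases w) (auto dest: single_valuedD)

lemma word_graph_foldr_push:
  assumes "\<And>p. p \<in> set u \<Longrightarrow> single_valued p"
  shows "word_graph v O word_graph u \<subseteq> word_graph (foldr push u v)"
  using assms
proof (induction u)
  case (Cons p u)
  have "word_graph v O word_graph (p # u) \<subseteq> word_graph (foldr push u v) O p"
    using Cons by auto
  also have "\<dots> \<subseteq> word_graph (foldr push (p # u) v)"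
    using word_graph_push[of p] Cons.prems by simp
  finally show ?case .
qed simp

locale free_group_of_maps =
  fixes P :: "'c pmap set"
  assumes converse_closed: "p \<in> P \<Longrightarrow> p\<inverse> \<in> P"
    and maps_single_valued: "p \<in> P \<Longrightarrow> single_valued p"

sublocale free_group_of_maps \<subseteq> group "free_group P"
  by (rule group_free_group) (rule converse_closed)

context free_group_of_maps
begin

lemma carrierD: "u \<in> carrier (free_group P) \<Longrightarrow> set u \<subseteq> P \<and> reduced u"
  by (simp add: free_group_def)

lemma mult_word: "u \<otimes>\<^bsub>free_group P\<^esub> v = foldr push u v"
  by (simp add: free_group_def)

lemma one_word: "\<one>\<^bsub>free_group P\<^esub> = []"
  by (simp add: free_group_def)

lemma word_graph_one: "word_graph \<one>\<^bsub>free_group P\<^esub> = Id"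
  by (simp add: one_word)

lemma singleton_in_carrier: "p \<in> P \<Longrightarrow> [p] \<in> carrier (free_group P)"
  by (simp add: free_group_def)

lemma inv_word:
  assumes u: "u \<in> carrier (free_group P)"
  shows "inv\<^bsub>free_group P\<^esub> u = foldr push (rev (map converse u)) []"
proof (rule inv_equality)
  show "foldr push (rev (map converse u)) [] \<otimes>\<^bsub>free_group P\<^esub> u = \<one>\<^bsub>free_group P\<^esub>"
    using carrierD[OF u] foldr_push_inverse[of "[]" u]
    by (simp add: mult_word one_word foldr_push_assoc foldr_push_Nil)
  show "foldr push (rev (map converse u)) [] \<in> carrier (free_group P)"
    using carrierD[OF u] converse_closed foldr_push_set[of "rev (map converse u)" "[]"]
    by (auto simp: free_group_def foldr_push_reduced)
qed fact

lemma word_graph_mult: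
  assumes "u \<in> carrier (free_group P)"
  shows "word_graph v O word_graph u \<subseteq> word_graph (u \<otimes>\<^bsub>free_group P\<^esub> v)"
  unfolding mult_word using carrierD[OF assms] maps_single_valued
  by (intro word_graph_foldr_push) auto

lemma word_graph_inv:
  assumes "u \<in> carrier (free_group P)"
  shows "(word_graph u)\<inverse> \<subseteq> word_graph (inv\<^bsub>free_group P\<^esub> u)"
  using carrierD[OF assms] converse_closed maps_single_valued
    word_graph_foldr_push[of "rev (map converse u)" "[]"]
  by (auto simp: inv_word[OF assms] word_graph_rev_converse)

text \<open>Membership only asks for one pair in the graph, so the inclusions for products and
  inverses are enough even though graphs may grow under reduction.\<close>

lemma fix_subgroup_subgroup: "subgroup (fix_subgroup P c) (free_group P)"
proof (rule subgroupI)
  show "fix_subgroup P c \<subseteq> carrier (free_group P)" by (auto simp: fix_subgroup_def)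
  show "fix_subgroup P c \<noteq> {}"
    using one_closed by (auto simp: fix_subgroup_def one_word intro!: exI[of _ "[]"])
next
  fix u assume u: "u \<in> fix_subgroup P c"
  then show "inv\<^bsub>free_group P\<^esub> u \<in> fix_subgroup P c"
    using word_graph_inv[of u] by (auto simp: fix_subgroup_def)
  fix v assume v: "v \<in> fix_subgroup P c"
  show "u \<otimes>\<^bsub>free_group P\<^esub> v \<in> fix_subgroup P c"
    using u v word_graph_mult[of u v] by (auto simp: fix_subgroup_def)
qed

end


section \<open>The structure on cosets\<close>

locale factorized =
  fixes L :: "'r language" and C :: "('r, 'c) rel_struct"
    and n :: nat and Cs :: "nat \<Rightarrow> 'c set" and a :: "nat \<Rightarrow> 'c"
    and N :: "nat \<Rightarrow> 'c pmap list set"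
  assumes structure_C: "is_structure L C"
    and factorization: "natural_factorization L C n Cs a"
    and N_normal: "i \<in> {1..n} \<Longrightarrow> N i \<lhd> \<F> L C"

sublocale factorized \<subseteq> free_group_of_maps "proper_isos L C"
  by unfold_locales (auto intro: proper_isos_converse proper_isos_single_valued)

context factorized
begin

abbreviation "P \<equiv> proper_isos L C"
abbreviation "G \<equiv> \<F> L C"
abbreviation "K \<equiv> NH L C a N"
abbreviation "\<Gamma> \<equiv> Gamma L C n a N"
abbreviation "\<pi> \<equiv> Gamma_embed L C n Cs a N"

text \<open>Extends \<open>Phi\<close> from the generators to the whole group, so that claims about
  \<open>Phi\<close> become facts about a group action.\<close>

definition translate :: "'c pmap list \<Rightarrow> nat \<times> 'c pmap list set \<Rightarrow> nat \<times> 'c pmap list set" where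
  "translate g = (\<lambda>(i, X). (i, g <#\<^bsub>G\<^esub> X))"

section \<open>Cosets of the subgroups \<open>K i\<close>\<close>

lemma K_subgroup: "i \<in> {1..n} \<Longrightarrow> subgroup (K i) G"
  unfolding NH_def by (intro mult_norm_subgroup N_normal fix_subgroup_subgroup)

lemma K_subset: "i \<in> {1..n} \<Longrightarrow> K i \<subseteq> carrier G"
  using K_subgroup by (simp add: subgroup.subset)

lemma fix_subset_K:
  assumes "i \<in> {1..n}"
  shows "fix_subgroup P (a i) \<subseteq> K i"
proof
  fix g assume g: "g \<in> fix_subgroup P (a i)"
  have "\<one>\<^bsub>G\<^esub> \<in> N i" using N_normal[OF assms] by (simp add: normal_def subgroup.one_closed)
  moreover have "\<one>\<^bsub>G\<^esub> \<otimes>\<^bsub>G\<^esub> g = g" using g by (simp add: fix_subgroup_def)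
  ultimately show "g \<in> K i" using g unfolding NH_def set_mult_def by force
qed

text \<open>The inverse of \<open>u\<close> times \<open>v\<close> carries \<open>a i\<close> back
  to itself, so it lies in the stabilizer of \<open>a i\<close> and hence in
  \<open>K i\<close>.\<close>

lemma coset_eq_of_same_value:
  assumes i: "i \<in> {1..n}" and u: "u \<in> carrier G" "(a i, c) \<in> word_graph u"
    and v: "v \<in> carrier G" "(a i, c) \<in> word_graph v"
  shows "u <#\<^bsub>G\<^esub> K i = v <#\<^bsub>G\<^esub> K i"
proof (rule l_repr_independence)
  have "(a i, a i) \<in> word_graph v O word_graph (inv\<^bsub>G\<^esub> u)"
    using u v word_graph_inv[OF u(1)] by auto
  then have "(a i, a i) \<in> word_graph (inv\<^bsub>G\<^esub> u \<otimes>\<^bsub>G\<^esub> v)"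
    using word_graph_mult u by blast
  then have "inv\<^bsub>G\<^esub> u \<otimes>\<^bsub>G\<^esub> v \<in> K i"
    using fix_subset_K[OF i] u v by (auto simp: fix_subgroup_def)
  moreover have "u \<otimes>\<^bsub>G\<^esub> (inv\<^bsub>G\<^esub> u \<otimes>\<^bsub>G\<^esub> v) = v"
    using u v by (simp add: m_assoc[symmetric])
  ultimately show "v \<in> u <#\<^bsub>G\<^esub> K i" unfolding l_coset_def by force
qed (use u i K_subgroup in auto)

lemma letter_closed: "p \<in> partial_isos L C \<Longrightarrow> letter p \<in> carrier G"
  by (auto simp: letter_def free_group_def proper_isos_def)

lemma letter_proper: "p \<in> P \<Longrightarrow> letter p = [p]"
  by (simp add: letter_def proper_isos_def)

lemma word_graph_letter: "(x, y) \<in> p \<Longrightarrow> (x, y) \<in> word_graph (letter p)"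
  by (auto simp: letter_def)

section \<open>Blocks of the factorization and the map of \<open>C\<close> into the cosets\<close>

lemma blocks:
  assumes "i \<in> {1..n}"
  shows "a i \<in> Cs i" "Cs i \<subseteq> universe C" "x \<in> Cs i \<Longrightarrow> y \<in> Cs i \<Longrightarrow> {(x, y)} \<in> partial_isos L C"
  using factorization assms
  by (auto simp: natural_factorization_def pointwise_isomorphic_def)

lemma block_exists:
  assumes "c \<in> universe C"
  obtains i where "i \<in> {1..n}" "c \<in> Cs i"
  using factorization assms unfolding natural_factorization_def by blast

text \<open>Restricting \<open>p\<close> to the point \<open>x\<close> shows that \<open>x\<close>
  and \<open>y\<close> agree on constant tuples. Adding \<open>y\<close> to the block keeps it
  pointwise isomorphic, and the block is maximal.\<close>

lemma block_closed:
  assumes i: "i \<in> {1..n}" and x: "x \<in> Cs i" and xy: "(x, y) \<in> p" and p: "p \<in> partial_isos L C"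
  shows "y \<in> Cs i"
proof -
  have "{(x, y)} \<in> partial_isos L C" using partial_isos_mono[OF p] xy by auto
  then have "pointwise_isomorphic L C (insert y (Cs i))"
    using blocks[OF i] x
    unfolding pointwise_isomorphic_def partial_isos_singleton_iff by blast
  then have "insert y (Cs i) = Cs i"
    using factorization i unfolding natural_factorization_def by blast
  then show ?thesis by blast
qed

text \<open>Eliminates both choices made in \<open>Gamma_embed\<close>: disjointness of the blocks
  pins down the index, and any group element whose word carries \<open>a i\<close> to
  \<open>c\<close> may replace the chosen partial isomorphism.\<close>

lemma Gamma_embed_eq:
  assumes i: "i \<in> {1..n}" and c: "c \<in> Cs i" and u: "u \<in> carrier G" "(a i, c) \<in> word_graph u"
  shows "\<pi> c = (i, u <#\<^bsub>G\<^esub> K i)"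
proof -
  have The: "(THE i. i \<in> {1..n} \<and> c \<in> Cs i) = i"
  proof (rule the_equality)
    have "disjoint_family_on Cs {1..n}"
      using factorization by (simp add: natural_factorization_def)
    then show "j = i" if "j \<in> {1..n} \<and> c \<in> Cs j" for j
      using that i c disjoint_family_onD[of Cs "{1..n}" i j] by blast
  qed (use i c in blast)
  show ?thesis
  proof (cases "c = a i")
    case True
    \<comment> \<open>The unit also carries \<open>a i\<close> to \<open>c\<close> here, and its
      coset is \<open>K i\<close>.\<close>
    have "u <#\<^bsub>G\<^esub> K i = \<one>\<^bsub>G\<^esub> <#\<^bsub>G\<^esub> K i"
      using i u True by (intro coset_eq_of_same_value[where c = c]) (auto simp: word_graph_one)
    also have "\<dots> = K i" by (rule lcos_mult_one[OF K_subset[OF i]])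
    finally show ?thesis using True The by (simp add: Gamma_embed_def)
  next
    case False
    let ?p = "SOME p. p \<in> P \<and> (a i, c) \<in> p"
    \<comment> \<open>The one-point map is proper because \<open>c\<close> differs from
      \<open>a i\<close>; it shows that there is something for \<open>SOME\<close> to
      choose.\<close>
    have "{(a i, c)} \<in> P" using blocks[OF i] c False by (auto simp: proper_isos_def)
    then have p: "?p \<in> P \<and> (a i, c) \<in> ?p"
      by (intro someI[of "\<lambda>p. p \<in> P \<and> (a i, c) \<in> p" "{(a i, c)}"]) simp
    have "letter ?p <#\<^bsub>G\<^esub> K i = u <#\<^bsub>G\<^esub> K i"
      using i u p by (intro coset_eq_of_same_value[where c = c])
        (auto intro: letter_closed word_graph_letter proper_isosD)
    then show ?thesis using False The by (simp add: Gamma_embed_def)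
  qed
qed

lemma Gamma_embed_partial_iso:
  assumes "i \<in> {1..n}" "p \<in> partial_isos L C" "(a i, c) \<in> p"
  shows "\<pi> c = (i, letter p <#\<^bsub>G\<^esub> K i)"
  using assms block_closed[OF assms(1) blocks(1)[OF assms(1)] assms(3,2)]
  by (intro Gamma_embed_eq letter_closed word_graph_letter)

lemma Gamma_embed_cases:
  assumes "c \<in> universe C"
  obtains i p where "i \<in> {1..n}" "c \<in> Cs i" "p \<in> partial_isos L C" "(a i, c) \<in> p"
    "\<pi> c = (i, letter p <#\<^bsub>G\<^esub> K i)"
proof -
  obtain i where i: "i \<in> {1..n}" "c \<in> Cs i" using block_exists[OF assms] .
  then have "{(a i, c)} \<in> partial_isos L C" using blocks by blast
  with i that Gamma_embed_partial_iso show ?thesis by blast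
qed

section \<open>The coset structure as the union of the translates of the image of
  \<open>C\<close>\<close>

lemma translate_coset:
  assumes "i \<in> {1..n}" "g \<in> carrier G" "h \<in> carrier G"
  shows "translate g (i, h <#\<^bsub>G\<^esub> K i) = (i, (g \<otimes>\<^bsub>G\<^esub> h) <#\<^bsub>G\<^esub> K i)"
  using assms K_subset by (simp add: translate_def lcos_m_assoc)

text \<open>The coset of \<open>g\<close> in block \<open>i\<close> is the translate by
  \<open>g\<close> of \<open>\<pi> (a i)\<close>. Together with \<open>rel_Gamma\<close>, this lets
  most later arguments speak of a group element and a point of \<open>C\<close> only, not of indices
  and cosets.\<close>

lemma universe_Gamma: "universe \<Gamma> = {translate g (\<pi> c) | g c. g \<in> carrier G \<and> c \<in> universe C}"
proof (intro equalityI subsetI)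
  fix x assume "x \<in> universe \<Gamma>"
  then obtain i g where x: "x = (i, g <#\<^bsub>G\<^esub> K i)" "i \<in> {1..n}" "g \<in> carrier G"
    by (auto simp: Gamma_def)
  then have "x = translate g (\<pi> (a i))"
    using Gamma_embed_eq[of i "a i" "\<one>\<^bsub>G\<^esub>"] blocks(1)
    by (simp add: translate_coset word_graph_one)
  then show "x \<in> {translate g (\<pi> c) | g c. g \<in> carrier G \<and> c \<in> universe C}" using x blocks by blast
next
  fix x assume "x \<in> {translate g (\<pi> c) | g c. g \<in> carrier G \<and> c \<in> universe C}"
  then obtain g c where x: "x = translate g (\<pi> c)" "g \<in> carrier G" "c \<in> universe C" by blast
  obtain i p where "i \<in> {1..n}" "p \<in> partial_isos L C" "\<pi> c = (i, letter p <#\<^bsub>G\<^esub> K i)"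
    using x(3) by (rule Gamma_embed_cases)
  then show "x \<in> universe \<Gamma>"
    using x letter_closed by (auto simp: translate_coset Gamma_def)
qed

text \<open>A triple \<open>(i, p, b)\<close> contributes the coset of \<open>g\<close> times
  \<open>letter p\<close>, which is the translate by \<open>g\<close> of \<open>\<pi> b\<close>. It
  thus enters only through its value \<open>b\<close>.\<close>

lemma rel_Gamma:
  assumes R: "R \<in> symbols L"
  shows "rel \<Gamma> R = {map (\<lambda>b. translate g (\<pi> b)) bs | g bs. g \<in> carrier G \<and> bs \<in> rel C R}"
proof (intro equalityI subsetI)
  fix xs assume "xs \<in> rel \<Gamma> R"
  then obtain g ts where xs: "xs = map (\<lambda>(i, p, b). (i, (g \<otimes>\<^bsub>G\<^esub> letter p) <#\<^bsub>G\<^esub> K i)) ts"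
    and g: "g \<in> carrier G" and R: "map (\<lambda>(i, p, b). b) ts \<in> rel C R"
    and ts: "\<forall>(i, p, b)\<in>set ts. i \<in> {1..n} \<and> p \<in> partial_isos L C \<and> (a i, b) \<in> p"
    unfolding Gamma_def rel_struct.simps mem_Collect_eq by (elim exE conjE)
  have "xs = map (\<lambda>b. translate g (\<pi> b)) (map (\<lambda>(i, p, b). b) ts)"
    unfolding xs map_map o_def
  proof (rule map_cong[OF refl], clarify)
    fix i p b assume "(i, p, b) \<in> set ts"
    then have "i \<in> {1..n}" "p \<in> partial_isos L C" "(a i, b) \<in> p" using ts by auto
    then show "(i, (g \<otimes>\<^bsub>G\<^esub> letter p) <#\<^bsub>G\<^esub> K i) = translate g (\<pi> b)"
      using Gamma_embed_partial_iso g letter_closed by (simp add: translate_coset)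
  qed
  then show "xs \<in> {map (\<lambda>b. translate g (\<pi> b)) bs | g bs. g \<in> carrier G \<and> bs \<in> rel C R}"
    using g R by blast
next
  fix xs assume "xs \<in> {map (\<lambda>b. translate g (\<pi> b)) bs | g bs. g \<in> carrier G \<and> bs \<in> rel C R}"
  then obtain g bs where xs: "xs = map (\<lambda>b. translate g (\<pi> b)) bs" and g: "g \<in> carrier G"
    and bs: "bs \<in> rel C R" by blast
  have len: "length bs = arity L R" and sub: "set bs \<subseteq> universe C"
    using structure_C R bs by (auto simp: is_structure_def)
  \<comment> \<open>Each entry of \<open>bs\<close> must be completed to a triple. Choosing the
    triple as a function of the point, not of the position, gives the list directly as
    \<open>map t bs\<close>.\<close>
  have "\<forall>b\<in>universe C. \<exists>t. fst t \<in> {1..n} \<and> fst (snd t) \<in> partial_isos L C \<and>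
      (a (fst t), b) \<in> fst (snd t) \<and> snd (snd t) = b \<and>
      \<pi> b = (fst t, letter (fst (snd t)) <#\<^bsub>G\<^esub> K (fst t))"
  proof
    fix b assume "b \<in> universe C"
    then obtain i p where "i \<in> {1..n}" "p \<in> partial_isos L C" "(a i, b) \<in> p"
      "\<pi> b = (i, letter p <#\<^bsub>G\<^esub> K i)" by (rule Gamma_embed_cases)
    then show "\<exists>t. fst t \<in> {1..n} \<and> fst (snd t) \<in> partial_isos L C \<and>
        (a (fst t), b) \<in> fst (snd t) \<and> snd (snd t) = b \<and>
        \<pi> b = (fst t, letter (fst (snd t)) <#\<^bsub>G\<^esub> K (fst t))"
      by (intro exI[of _ "(i, p, b)"]) simp
  qed
  from bchoice[OF this] obtain t where t: "\<And>b. b \<in> universe C \<Longrightarrow>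
      fst (t b) \<in> {1..n} \<and> fst (snd (t b)) \<in> partial_isos L C \<and>
      (a (fst (t b)), b) \<in> fst (snd (t b)) \<and> snd (snd (t b)) = b \<and>
      \<pi> b = (fst (t b), letter (fst (snd (t b))) <#\<^bsub>G\<^esub> K (fst (t b)))"
    by blast
  have "xs = map (\<lambda>(i, p, b). (i, (g \<otimes>\<^bsub>G\<^esub> letter p) <#\<^bsub>G\<^esub> K i)) (map t bs)"
    unfolding xs map_map o_def
  proof (rule map_cong[OF refl])
    fix b assume "b \<in> set bs"
    then have "b \<in> universe C" using sub by blast
    from t[OF this] show "translate g (\<pi> b) =
        (case t b of (i, p, b) \<Rightarrow> (i, (g \<otimes>\<^bsub>G\<^esub> letter p) <#\<^bsub>G\<^esub> K i))"
      using g letter_closed by (simp add: translate_coset split_beta)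
  qed
  moreover have "\<forall>(i, p, b)\<in>set (map t bs). i \<in> {1..n} \<and> p \<in> partial_isos L C \<and> (a i, b) \<in> p"
  proof
    fix z assume "z \<in> set (map t bs)"
    then obtain b where "b \<in> universe C" "z = t b" using sub by auto
    with t[OF this(1)]
    show "case z of (i, p, b) \<Rightarrow> i \<in> {1..n} \<and> p \<in> partial_isos L C \<and> (a i, b) \<in> p"
      by (simp add: split_beta)
  qed
  moreover have "length (map t bs) = arity L R" using len by simp
  moreover have "map (\<lambda>(i, p, b). b) (map t bs) = bs"
    unfolding map_map using t sub by (intro map_idI) (simp add: split_beta subset_iff)
  then have "map (\<lambda>(i, p, b). b) (map t bs) \<in> rel C R" using bs by (rule ssubst)
  ultimately show "xs \<in> rel \<Gamma> R"
    using g unfolding Gamma_def rel_struct.simps mem_Collect_eq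
    by (intro exI[of _ g] exI[of _ "map t bs"] conjI)
qed

lemma Gamma_embed_in_universe: "c \<in> universe C \<Longrightarrow> \<pi> c \<in> universe \<Gamma>"
  by (erule Gamma_embed_cases) (auto simp: Gamma_def letter_closed)

section \<open>Left translations as automorphisms\<close>

lemma translate_mult:
  assumes "x \<in> universe \<Gamma>" "g \<in> carrier G" "h \<in> carrier G"
  shows "translate g (translate h x) = translate (g \<otimes>\<^bsub>G\<^esub> h) x"
  using assms K_subset by (auto simp: Gamma_def translate_coset m_assoc)

lemma translate_one: "x \<in> universe \<Gamma> \<Longrightarrow> translate \<one>\<^bsub>G\<^esub> x = x"
  by (auto simp: Gamma_def translate_coset)

lemma translate_closed: "x \<in> universe \<Gamma> \<Longrightarrow> g \<in> carrier G \<Longrightarrow> translate g x \<in> universe \<Gamma>"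
  by (fastforce simp: Gamma_def translate_coset)

lemma is_structure_Gamma: "is_structure L \<Gamma>"
  unfolding is_structure_def
proof (intro ballI)
  fix R xs assume R: "R \<in> symbols L" and xs: "xs \<in> rel \<Gamma> R"
  then show "length xs = arity L R \<and> set xs \<subseteq> universe \<Gamma>"
    using structure_C
    by (fastforce simp: rel_Gamma is_structure_def translate_closed Gamma_embed_in_universe)
qed

lemma rel_translate:
  assumes R: "R \<in> symbols L" and g: "g \<in> carrier G" and xs: "xs \<in> rel \<Gamma> R"
  shows "map (translate g) xs \<in> rel \<Gamma> R"
proof -
  obtain h bs where h: "xs = map (\<lambda>b. translate h (\<pi> b)) bs" "h \<in> carrier G" "bs \<in> rel C R"
    using xs unfolding rel_Gamma[OF R] by blast
  then have "map (translate g) xs = map (\<lambda>b. translate (g \<otimes>\<^bsub>G\<^esub> h) (\<pi> b)) bs"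
    using structure_C R g
    by (auto simp: translate_mult is_structure_def Gamma_embed_in_universe subset_iff)
  then show ?thesis using g h unfolding rel_Gamma[OF R] by blast
qed

lemma translate_inv:
  assumes "x \<in> universe \<Gamma>" "g \<in> carrier G"
  shows "translate (inv\<^bsub>G\<^esub> g) (translate g x) = x" "translate g (translate (inv\<^bsub>G\<^esub> g) x) = x"
  using assms by (simp_all add: translate_mult translate_one)

lemma translate_bij:
  assumes "g \<in> carrier G"
  shows "bij_betw (translate g) (universe \<Gamma>) (universe \<Gamma>)"
  using assms by (intro bij_betw_byWitness[where f' = "translate (inv\<^bsub>G\<^esub> g)"])
    (auto simp: translate_inv translate_closed)

lemma translate_automorphism:
  assumes g: "g \<in> carrier G"
  shows "is_automorphism L \<Gamma> (translate g)"
proof -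
  have "xs \<in> rel \<Gamma> R" if "R \<in> symbols L" "set xs \<subseteq> universe \<Gamma>" "map (translate g) xs \<in> rel \<Gamma> R" for R xs
  proof -
    \<comment> \<open>Reflection of relations is preservation for the inverse element, applied to
      the image tuple.\<close>
    have "map (translate (inv\<^bsub>G\<^esub> g)) (map (translate g) xs) = xs"
      unfolding map_map using that(2) g by (intro map_idI) (simp add: translate_inv subsetD)
    moreover have "map (translate (inv\<^bsub>G\<^esub> g)) (map (translate g) xs) \<in> rel \<Gamma> R"
      by (rule rel_translate[OF that(1) inv_closed[OF g] that(3)])
    ultimately show ?thesis by (simp only:)
  qed
  with rel_translate[OF _ g] translate_bij[OF g] show ?thesis
    unfolding is_iso_def is_embedding_def bij_betw_def by (metis order_refl)
qed

section \<open>Extension property, minimality and finiteness\<close>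

lemma Phi_eq_translate: "p \<in> P \<Longrightarrow> Phi L C p = translate [p]"
  by (simp add: Phi_def translate_def letter_proper)

text \<open>If \<open>q\<close> carries \<open>a i\<close> to \<open>x\<close>, then the product of
  \<open>p\<close> and \<open>q\<close> carries \<open>a i\<close> to \<open>y\<close>, and
  \<open>y\<close> stays in the block of \<open>x\<close>. So both sides are the coset of that
  product.\<close>

lemma translate_Gamma_embed:
  assumes p: "p \<in> P" and xy: "(x, y) \<in> p"
  shows "translate [p] (\<pi> x) = \<pi> y"
proof -
  have "x \<in> universe C" using proper_isosD[OF p] xy unfolding partial_isos_iff by blast
  then obtain i q where i: "i \<in> {1..n}" "x \<in> Cs i" and q: "q \<in> partial_isos L C" "(a i, x) \<in> q"
    and x: "\<pi> x = (i, letter q <#\<^bsub>G\<^esub> K i)"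
    by (rule Gamma_embed_cases)
  have "(a i, y) \<in> word_graph (letter q) O word_graph [p]"
    using word_graph_letter[OF q(2)] xy by auto
  then have "(a i, y) \<in> word_graph ([p] \<otimes>\<^bsub>G\<^esub> letter q)"
    using word_graph_mult[OF singleton_in_carrier[OF p]] by blast
  moreover have "y \<in> Cs i" using block_closed[OF i xy proper_isosD[OF p]] .
  ultimately have "\<pi> y = (i, ([p] \<otimes>\<^bsub>G\<^esub> letter q) <#\<^bsub>G\<^esub> K i)"
    using i p q letter_closed singleton_in_carrier by (intro Gamma_embed_eq) auto
  then show ?thesis
    using x i p q letter_closed singleton_in_carrier by (simp add: translate_coset)
qed

lemma foldr_Phi:
  "w \<in> carrier G \<Longrightarrow> x \<in> universe \<Gamma> \<Longrightarrow> foldr (Phi L C) w x = translate w x"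
proof (induction w)
  case Nil
  then show ?case using translate_one by (simp add: one_word)
next
  case (Cons p w)
  then have pw: "set (p # w) \<subseteq> P" "reduced (p # w)" using carrierD by blast+
  \<comment> \<open>In a reduced word the first letter does not cancel against the tail, so their
    product is the word itself; the tail is again reduced, which keeps the induction inside the
    group.\<close>
  then have p: "p \<in> P" and w: "w \<in> carrier G" and "[p] \<otimes>\<^bsub>G\<^esub> w = p # w"
    by (cases w; simp add: free_group_def)+
  then show ?case
    using Cons translate_mult[of x "[p]" w] singleton_in_carrier[OF p] by (simp add: Phi_eq_translate)
qed

text \<open>The reduced word of \<open>g\<close> itself serves as the required list of partial
  isomorphisms.\<close>

lemma Gamma_minimal: "HL_minimal L C \<Gamma> \<pi> (Phi L C)"
  unfolding HL_minimal_def
proof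
  fix b assume "b \<in> universe \<Gamma> - \<pi> ` universe C"
  then obtain g c where "b = translate g (\<pi> c)" "g \<in> carrier G" "c \<in> universe C"
    unfolding universe_Gamma by blast
  then show "\<exists>ps c. set ps \<subseteq> P \<and> c \<in> universe C \<and> b = foldr (Phi L C) ps (\<pi> c)"
    using carrierD[of g]
    by (intro exI[of _ g] exI[of _ c]) (simp add: foldr_Phi Gamma_embed_in_universe)
qed

text \<open>For large \<open>N i\<close> the map \<open>\<pi>\<close> may identify points of a
  block, so the embedding property is a hypothesis here. It is supplied later through the map to
  \<open>D\<close>.\<close>

lemma Gamma_HL_extension:
  assumes "is_embedding L C \<Gamma> \<pi>"
  shows "HL_extension L C \<Gamma> \<pi> (Phi L C)"
  unfolding HL_extension_def
proof (intro conjI ballI is_structure_Gamma assms)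
  fix p assume p: "p \<in> P"
  note cp = singleton_in_carrier[OF p]
  show "is_automorphism L \<Gamma> (Phi L C p)"
    using translate_automorphism[OF cp] by (simp add: Phi_eq_translate p)
  show "case z of (x, y) \<Rightarrow> Phi L C p (\<pi> x) = \<pi> y" if "z \<in> p" for z
    using that translate_Gamma_embed[OF p] by (auto simp: Phi_eq_translate p)
  fix d assume d: "d \<in> universe \<Gamma>"
  have "Phi L C (p\<inverse>) d = translate (inv\<^bsub>G\<^esub> [p]) d"
    using p by (simp add: Phi_eq_translate proper_isos_converse inv_word[OF cp])
  moreover have "inv_into (universe \<Gamma>) (translate [p]) d = translate (inv\<^bsub>G\<^esub> [p]) d"
    using translate_bij[OF cp] d cp
    by (intro inv_into_f_eq) (auto simp: bij_betw_def translate_inv translate_closed)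
  ultimately show "Phi L C (p\<inverse>) d = inv_into (universe \<Gamma>) (Phi L C p) d"
    using p by (simp add: Phi_eq_translate)
qed

text \<open>By normality of \<open>N i\<close>, a left coset of \<open>K i\<close> is a right coset
  of \<open>N i\<close> multiplied by the stabilizer of \<open>a i\<close>. Each block is thus the
  image of a finite set of cosets.\<close>

lemma finite_Gamma:
  assumes "\<And>i. i \<in> {1..n} \<Longrightarrow> finite (rcosets\<^bsub>G\<^esub> (N i))"
  shows "finite (universe \<Gamma>)"
proof -
  have "finite {g <#\<^bsub>G\<^esub> K i | g. g \<in> carrier G}" if i: "i \<in> {1..n}" for i
  proof -
    interpret normal "N i" G by (rule N_normal[OF i])
    have "g <#\<^bsub>G\<^esub> K i = (N i #>\<^bsub>G\<^esub> g) <#>\<^bsub>G\<^esub> fix_subgroup P (a i)" if "g \<in> carrier G" for g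
      using that coset_eq subset
      by (simp add: NH_def lcos_m_assoc l_coset_eq_set_mult set_mult_assoc fix_subgroup_def subset_iff)
    then have "{g <#\<^bsub>G\<^esub> K i | g. g \<in> carrier G} \<subseteq>
        (\<lambda>X. X <#>\<^bsub>G\<^esub> fix_subgroup P (a i)) ` (rcosets\<^bsub>G\<^esub> (N i))"
      by (auto simp: RCOSETS_def)
    then show ?thesis using assms[OF i] finite_surj by blast
  qed
  then have "finite (SIGMA i:{1..n}. {g <#\<^bsub>G\<^esub> K i | g. g \<in> carrier G})" by blast
  then show ?thesis by (rule finite_subset[rotated]) (auto simp: Gamma_def)
qed

end


section \<open>Mapping the cosets to a given extension\<close>

lemma is_hom_compose:
  assumes f: "is_hom L M1 M2 f" and g: "is_hom L M2 M3 g"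
  shows "is_hom L M1 M3 (g \<circ> f)"
  unfolding is_hom_def
proof (intro conjI ballI)
  show "(g \<circ> f) ` universe M1 \<subseteq> universe M3"
    using f g by (fastforce simp: is_hom_def)
  fix R xs assume R: "R \<in> symbols L" "xs \<in> rel M1 R"
  then have "map f xs \<in> rel M2 R" using f by (simp add: is_hom_def)
  then have "map g (map f xs) \<in> rel M3 R" using g R by (simp add: is_hom_def del: map_map)
  then show "map (g \<circ> f) xs \<in> rel M3 R" by simp
qed

section \<open>The action of the free group on a given extension, and its kernel\<close>

locale HL_ext =
  fixes L :: "'r language" and C :: "('r, 'c) rel_struct"
    and D :: "('r, 'd) rel_struct" and e :: "'c \<Rightarrow> 'd" and \<phi> :: "'c pmap \<Rightarrow> 'd \<Rightarrow> 'd"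
  assumes extension: "HL_extension L C D e \<phi>"

sublocale HL_ext \<subseteq> free_group_of_maps "proper_isos L C"
  by unfold_locales (auto intro: proper_isos_converse proper_isos_single_valued)

context HL_ext
begin

text \<open>The restriction makes the value extensional, as membership in \<open>BijGroup\<close>
  requires.\<close>

definition action :: "'c pmap list \<Rightarrow> 'd \<Rightarrow> 'd" where
  "action w = restrict (foldr \<phi> w) (universe D)"

definition action_kernel :: "'c pmap list set" where
  "action_kernel = kernel (\<F> L C) (BijGroup (universe D)) action"

lemma phi_automorphism: "p \<in> proper_isos L C \<Longrightarrow> is_automorphism L D (\<phi> p)"
  using extension by (simp add: HL_extension_def)

lemma phi_bij: "p \<in> proper_isos L C \<Longrightarrow> bij_betw (\<phi> p) (universe D) (universe D)"
  by (drule phi_automorphism) (simp add: is_iso_def is_embedding_def bij_betw_def)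

lemma phi_phi_converse:
  assumes "p \<in> proper_isos L C" "d \<in> universe D"
  shows "\<phi> p (\<phi> (p\<inverse>) d) = d"
proof -
  have "\<phi> (p\<inverse>) d = inv_into (universe D) (\<phi> p) d"
    using extension assms unfolding HL_extension_def by blast
  then show ?thesis using bij_betw_inv_into_right[OF phi_bij] assms by simp
qed

lemma foldr_phi_bij:
  "set w \<subseteq> proper_isos L C \<Longrightarrow> bij_betw (foldr \<phi> w) (universe D) (universe D)"
proof (induction w)
  case (Cons p w)
  then show ?case using bij_betw_trans[of "foldr \<phi> w" _ _ "\<phi> p"] phi_bij by (simp add: o_def)
qed (simp add: bij_betw_def)

text \<open>When \<open>push\<close> cancels, nothing is lost, since
  \<open>\<phi> (p\<inverse>)\<close> undoes \<open>\<phi> p\<close>. This makes evaluation of words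
  compatible with the group product.\<close>

lemma foldr_phi_push:
  assumes "p \<in> proper_isos L C" "set w \<subseteq> proper_isos L C" "d \<in> universe D"
  shows "foldr \<phi> (push p w) d = \<phi> p (foldr \<phi> w d)"
proof (cases w)
  case (Cons q v)
  then show ?thesis
    using assms foldr_phi_bij[of v] phi_phi_converse by (auto simp: bij_betw_apply)
qed simp

lemma foldr_phi_foldr_push:
  assumes "set u \<subseteq> proper_isos L C" "set v \<subseteq> proper_isos L C" "d \<in> universe D"
  shows "foldr \<phi> (foldr push u v) d = foldr \<phi> u (foldr \<phi> v d)"
  using assms
proof (induction u)
  case (Cons p u)
  then have "set (foldr push u v) \<subseteq> proper_isos L C" using foldr_push_set[of u v] by auto
  then show ?case using Cons by (simp add: foldr_phi_push)
qed simp

lemma action_closed: "w \<in> carrier (\<F> L C) \<Longrightarrow> d \<in> universe D \<Longrightarrow> action w d \<in> universe D"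
  using foldr_phi_bij[of w] carrierD[of w] by (simp add: action_def bij_betw_apply)

lemma action_mult:
  assumes "u \<in> carrier (\<F> L C)" "v \<in> carrier (\<F> L C)" "d \<in> universe D"
  shows "action (u \<otimes>\<^bsub>\<F> L C\<^esub> v) d = action u (action v d)"
  using assms carrierD[OF assms(1)] carrierD[OF assms(2)] action_closed[OF assms(2,3)]
  by (simp add: action_def mult_word foldr_phi_foldr_push)

lemma action_hom: "group_hom (\<F> L C) (BijGroup (universe D)) action"
proof (intro group_hom.intro group_hom_axioms.intro group_BijGroup homI)
  show "action u \<in> carrier (BijGroup (universe D))" if "u \<in> carrier (\<F> L C)" for u
    using that foldr_phi_bij[of u] carrierD[of u]
    by (simp add: BijGroup_def Bij_def action_def bij_betw_restrict_eq)
  then show "action (u \<otimes>\<^bsub>\<F> L C\<^esub> v) = action u \<otimes>\<^bsub>BijGroup (universe D)\<^esub> action v"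
    if "u \<in> carrier (\<F> L C)" "v \<in> carrier (\<F> L C)" for u v
    using that action_mult[of u v]
    by (auto simp: BijGroup_def compose_def fun_eq_iff action_def)
qed (rule group_axioms)

lemma action_kernel_normal: "action_kernel \<lhd> \<F> L C"
  unfolding action_kernel_def by (rule group_hom.normal_kernel[OF action_hom])

lemma action_kernel_fixes: "w \<in> action_kernel \<Longrightarrow> d \<in> universe D \<Longrightarrow> action w d = d"
  by (auto simp: action_kernel_def kernel_def BijGroup_def)

text \<open>The quotient by the kernel injects into the permutations of \<open>universe D\<close>,
  and its elements are the cosets.\<close>

lemma finite_index_action_kernel:
  assumes "finite (universe D)"
  shows "finite (rcosets\<^bsub>\<F> L C\<^esub> action_kernel)"
proof -
  interpret group_hom "\<F> L C" "BijGroup (universe D)" action by (rule action_hom)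
  \<comment> \<open>Permutations are extensional functions on a finite set, so there are finitely
    many.\<close>
  have "Bij (universe D) \<subseteq> universe D \<rightarrow>\<^sub>E universe D"
    by (auto simp: Bij_def PiE_def bij_betw_def)
  then have "finite (carrier (BijGroup (universe D)))"
    using finite_PiE[of "universe D" "\<lambda>_. universe D"] assms
    by (auto simp: BijGroup_def intro: finite_subset)
  then have "finite ((\<lambda>X. the_elem (action ` X)) ` carrier (\<F> L C Mod action_kernel))"
    using FactGroup_the_elem_mem unfolding action_kernel_def by (blast intro: finite_subset)
  then have "finite (carrier (\<F> L C Mod action_kernel))"
    using FactGroup_inj_on unfolding action_kernel_def by (rule finite_imageD)
  then show ?thesis by (simp add: FactGroup_def)
qed

lemma e_closed: "c \<in> universe C \<Longrightarrow> e c \<in> universe D"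
  using extension by (auto simp: HL_extension_def is_embedding_def)

text \<open>Each \<open>\<phi> p\<close> extends \<open>p\<close>, so the total action on
  \<open>D\<close> agrees with the partial action on \<open>C\<close> wherever the latter is
  defined. In particular the stabilizer of \<open>a i\<close> fixes \<open>e (a i)\<close>.\<close>

lemma foldr_phi_word_graph:
  "set w \<subseteq> proper_isos L C \<Longrightarrow> (x, y) \<in> word_graph w \<Longrightarrow> foldr \<phi> w (e x) = e y"
proof (induction w arbitrary: y)
  case (Cons p w)
  then obtain z where "(x, z) \<in> word_graph w" "(z, y) \<in> p" by auto
  moreover have "\<phi> p (e z) = e y"
    using extension Cons.prems(1) \<open>(z, y) \<in> p\<close> by (auto simp: HL_extension_def)
  ultimately show ?case using Cons by simp
qed simp

lemma action_word_graph:
  assumes "w \<in> carrier (\<F> L C)" "(x, y) \<in> word_graph w" "x \<in> universe C"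
  shows "action w (e x) = e y"
  using assms carrierD[OF assms(1)] foldr_phi_word_graph by (simp add: action_def e_closed)

lemma foldr_phi_rel:
  "set w \<subseteq> proper_isos L C \<Longrightarrow> R \<in> symbols L \<Longrightarrow> ds \<in> rel D R \<Longrightarrow> map (foldr \<phi> w) ds \<in> rel D R"
proof (induction w)
  case (Cons p w)
  then have *: "map (foldr \<phi> w) ds \<in> rel D R" by simp
  \<comment> \<open>\<open>is_embedding\<close> speaks only of tuples of the right length over the
    universe, so the intermediate tuple must be known to be one.\<close>
  moreover have "set (map (foldr \<phi> w) ds) \<subseteq> universe D"
    "length (map (foldr \<phi> w) ds) = arity L R"
    using extension Cons.prems(2) * unfolding HL_extension_def is_structure_def by blast+
  moreover have "is_embedding L D D (\<phi> p)"
    using phi_automorphism Cons.prems(1) by (simp add: is_iso_def)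
  ultimately have "map (\<phi> p) (map (foldr \<phi> w) ds) \<in> rel D R"
    using Cons.prems(2) unfolding is_embedding_def by blast
  then show ?case by (simp add: o_def)
qed simp

lemma action_rel:
  assumes w: "w \<in> carrier (\<F> L C)" and R: "R \<in> symbols L" and ds: "ds \<in> rel D R"
  shows "map (action w) ds \<in> rel D R"
proof -
  have "set ds \<subseteq> universe D" using extension R ds by (auto simp: HL_extension_def is_structure_def)
  then have "map (action w) ds = map (foldr \<phi> w) ds" by (auto simp: action_def)
  moreover have "map (foldr \<phi> w) ds \<in> rel D R" using foldr_phi_rel carrierD[OF w] R ds by blast
  ultimately show ?thesis by (simp only:)
qed

end

section \<open>The map from the cosets of the kernel construction to \<open>D\<close>\<close>

locale factorized_HL_ext = HL_ext L C D e \<phi> + factorized L C n Cs a "\<lambda>_. action_kernel"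
  for L :: "'r language" and C :: "('r, 'c) rel_struct"
    and D :: "('r, 'd) rel_struct" and e :: "'c \<Rightarrow> 'd" and \<phi> :: "'c pmap \<Rightarrow> 'd \<Rightarrow> 'd"
    and n :: nat and Cs :: "nat \<Rightarrow> 'c set" and a :: "nat \<Rightarrow> 'c"
begin

definition \<psi> :: "nat \<times> 'c pmap list set \<Rightarrow> 'd" where
  "\<psi> = (\<lambda>(i, X). action (SOME g. g \<in> X) (e (a i)))"

text \<open>Every member of the coset is \<open>g\<close> times some \<open>u\<close> in the kernel
  times some \<open>v\<close> in the stabilizer; \<open>v\<close> and then \<open>u\<close> leave
  \<open>e (a i)\<close> in place, so the representative picked by \<open>SOME\<close> does not
  matter.\<close>

lemma psi_coset:
  assumes i: "i \<in> {1..n}" and g: "g \<in> carrier G"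
  shows "\<psi> (i, g <#\<^bsub>G\<^esub> K i) = action g (e (a i))"
proof -
  have ai: "a i \<in> universe C" using blocks[OF i] by blast
  have "action h (e (a i)) = action g (e (a i))" if h: "h \<in> g <#\<^bsub>G\<^esub> K i" for h
  proof -
    obtain u v where h: "h = g \<otimes>\<^bsub>G\<^esub> (u \<otimes>\<^bsub>G\<^esub> v)" and u: "u \<in> action_kernel"
      and v: "v \<in> fix_subgroup P (a i)"
      using h unfolding l_coset_def NH_def set_mult_def by blast
    have "u \<in> carrier G" using u by (simp add: action_kernel_def kernel_def)
    moreover have "v \<in> carrier G" "action v (e (a i)) = e (a i)"
      using v action_word_graph ai by (auto simp: fix_subgroup_def)
    ultimately show ?thesis
      using g u e_closed[OF ai] by (simp add: h action_mult action_kernel_fixes)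
  qed
  moreover have "g \<in> g <#\<^bsub>G\<^esub> K i"
    using g subgroup.one_closed[OF K_subgroup[OF i]] unfolding l_coset_def by force
  then have "(SOME h. h \<in> g <#\<^bsub>G\<^esub> K i) \<in> g <#\<^bsub>G\<^esub> K i" by (rule someI)
  ultimately show ?thesis by (simp add: \<psi>_def)
qed

text \<open>The letter carrying \<open>a i\<close> to \<open>c\<close> acts on \<open>D\<close> by
  sending \<open>e (a i)\<close> to \<open>e c\<close>. This matches the descriptions in
  \<open>universe_Gamma\<close> and \<open>rel_Gamma\<close>, and the properties of
  \<open>\<psi>\<close> follow from it.\<close>

lemma psi_translate:
  assumes g: "g \<in> carrier G" and c: "c \<in> universe C"
  shows "\<psi> (translate g (\<pi> c)) = action g (e c)"
proof -
  obtain i p where i: "i \<in> {1..n}" and p: "p \<in> partial_isos L C" "(a i, c) \<in> p"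
    and pi: "\<pi> c = (i, letter p <#\<^bsub>G\<^esub> K i)"
    using c by (rule Gamma_embed_cases)
  have "a i \<in> universe C" using blocks[OF i] by blast
  then show ?thesis
    using i p g letter_closed word_graph_letter[OF p(2)]
    by (simp add: pi translate_coset psi_coset action_mult action_word_graph e_closed)
qed

lemma psi_embed: "c \<in> universe C \<Longrightarrow> \<psi> (\<pi> c) = e c"
  using psi_translate[OF one_closed] translate_one[OF Gamma_embed_in_universe]
  by (simp add: action_def one_word e_closed)

text \<open>A related tuple of cosets is a translate of a related tuple of \<open>C\<close>;
  \<open>e\<close> carries the latter into \<open>D\<close>, where group elements preserve
  relations.\<close>

lemma psi_is_hom: "is_hom L \<Gamma> D \<psi>"
  unfolding is_hom_def
proof (intro conjI ballI)
  show "\<psi> ` universe \<Gamma> \<subseteq> universe D"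
    by (auto simp: universe_Gamma psi_translate action_closed e_closed)
  fix R xs assume R: "R \<in> symbols L" and "xs \<in> rel \<Gamma> R"
  then obtain g bs where xs: "xs = map (\<lambda>b. translate g (\<pi> b)) bs" and g: "g \<in> carrier G"
    and bs: "bs \<in> rel C R" by (auto simp: rel_Gamma)
  have len: "length bs = arity L R" and sub: "set bs \<subseteq> universe C"
    using structure_C R bs by (auto simp: is_structure_def)
  have "map e bs \<in> rel D R"
    using extension R bs len sub by (auto simp: HL_extension_def is_embedding_def)
  then have "map (action g) (map e bs) \<in> rel D R" by (rule action_rel[OF g R])
  moreover have "map \<psi> xs = map (action g) (map e bs)"
    using sub g by (auto simp: xs psi_translate)
  ultimately show "map \<psi> xs \<in> rel D R" by simp
qed

text \<open>As \<open>\<psi>\<close> after \<open>\<pi>\<close> is \<open>e\<close> on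
  \<open>C\<close>, injectivity and reflection of relations are inherited from
  \<open>e\<close>.\<close>

lemma Gamma_embed_is_embedding: "is_embedding L C \<Gamma> \<pi>"
  unfolding is_embedding_def
proof (intro conjI allI ballI impI)
  have e: "is_embedding L C D e" using extension by (simp add: HL_extension_def)
  then have "inj_on (\<psi> \<circ> \<pi>) (universe C)"
    by (simp add: is_embedding_def inj_on_def psi_embed)
  then show "inj_on \<pi> (universe C)" by (rule inj_on_imageI2)
  show "\<pi> ` universe C \<subseteq> universe \<Gamma>" using Gamma_embed_in_universe by blast
  fix R xs assume R: "R \<in> symbols L" and xs: "length xs = arity L R \<and> set xs \<subseteq> universe C"
  show "xs \<in> rel C R \<longleftrightarrow> map \<pi> xs \<in> rel \<Gamma> R"
  proof
    assume "xs \<in> rel C R"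
    \<comment> \<open>Preservation comes from \<open>rel_Gamma\<close> with the unit as translating
      element.\<close>
    moreover have "map \<pi> xs = map (\<lambda>b. translate \<one>\<^bsub>G\<^esub> (\<pi> b)) xs"
      using xs by (simp add: translate_one Gamma_embed_in_universe subset_iff)
    ultimately show "map \<pi> xs \<in> rel \<Gamma> R" unfolding rel_Gamma[OF R] using one_closed by blast
  next
    assume "map \<pi> xs \<in> rel \<Gamma> R"
    then have "map \<psi> (map \<pi> xs) \<in> rel D R" using psi_is_hom R unfolding is_hom_def by blast
    moreover have "map \<psi> (map \<pi> xs) = map e xs" using xs psi_embed by auto
    ultimately have "map e xs \<in> rel D R" by (simp only:)
    then show "xs \<in> rel C R" using e R xs unfolding is_embedding_def by blast
  qed
qed

lemma psi_Phi:
  assumes p: "p \<in> P" and x: "x \<in> universe \<Gamma>"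
  shows "\<psi> (Phi L C p x) = \<phi> p (\<psi> x)"
proof -
  obtain g c where g: "x = translate g (\<pi> c)" "g \<in> carrier G" "c \<in> universe C"
    using x unfolding universe_Gamma by blast
  note cp = singleton_in_carrier[OF p]
  have "\<psi> (Phi L C p x) = action [p] (action g (e c))"
    using g cp p
    by (simp add: Phi_eq_translate translate_mult Gamma_embed_in_universe psi_translate action_mult e_closed)
  also have "\<dots> = \<phi> p (action g (e c))"
    using action_closed g e_closed by (simp add: action_def)
  finally show ?thesis using g by (simp add: psi_translate)
qed

lemma psi_HL_hom: "HL_hom L C \<Gamma> \<pi> (Phi L C) D e \<phi> \<psi>"
  unfolding HL_hom_def using psi_is_hom psi_embed psi_Phi by blast

lemma psi_onto:
  assumes "HL_minimal L C D e \<phi>"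
  shows "\<psi> ` universe \<Gamma> = universe D"
proof (intro equalityI subsetI)
  fix b assume b: "b \<in> universe D"
  \<comment> \<open>Minimality covers only points outside the image of \<open>C\<close>; for points
    in the image the empty word serves.\<close>
  obtain ps c where ps: "set ps \<subseteq> P" and c: "c \<in> universe C" and b: "b = foldr \<phi> ps (e c)"
  proof (cases "b \<in> e ` universe C")
    case True
    then show ?thesis using that[of "[]"] by auto
  next
    case False
    then show ?thesis using assms b that unfolding HL_minimal_def by blast
  qed
  \<comment> \<open>The word \<open>ps\<close> need not be reduced, so it is not an element of the
    group; a preimage is instead built letter by letter, matching \<open>\<phi> p\<close> with
    \<open>Phi L C p\<close>.\<close>
  have "foldr \<phi> ps (e c) \<in> \<psi> ` universe \<Gamma>" using ps
  proof (induction ps)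
    case Nil
    then show ?case using psi_embed[OF c] Gamma_embed_in_universe[OF c] by force
  next
    case (Cons p ps)
    then obtain x where x: "foldr \<phi> ps (e c) = \<psi> x" "x \<in> universe \<Gamma>" by auto
    have "Phi L C p x \<in> universe \<Gamma>"
      using Cons.prems x translate_closed singleton_in_carrier by (simp add: Phi_eq_translate)
    then show ?case using psi_Phi[of p x] Cons.prems x by force
  qed
  then show "b \<in> \<psi> ` universe \<Gamma>" using b by simp
qed (use psi_is_hom in \<open>auto simp: is_hom_def\<close>)

lemma Gamma_free_of:
  assumes "free_of L \<T> D"
  shows "free_of L \<T> \<Gamma>"
  using assms is_hom_compose[OF _ psi_is_hom] unfolding free_of_def by blast

end

theorem theorem2p4:
  fixes L :: "'r language"
    and \<T> :: "('r, 't) rel_struct set"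
    and C :: "('r, 'c) rel_struct"
    and n :: nat and Cs :: "nat \<Rightarrow> 'c set" and a :: "nat \<Rightarrow> 'c"
    and D :: "('r, 'd) rel_struct" and e :: "'c \<Rightarrow> 'd"
    and \<phi> :: "'c pmap \<Rightarrow> 'd \<Rightarrow> 'd"
  assumes "finite (symbols L)"
    and "finite \<T>" and "\<forall>T\<in>\<T>. is_structure L T \<and> finite (universe T)"
    and "is_structure L C" and "finite (universe C)" and "free_of L \<T> C"
    and "natural_factorization L C n Cs a"
    and "HL_extension L C D e \<phi>" and "finite (universe D)" and "free_of L \<T> D"
    and "HL_minimal L C D e \<phi>"
  shows "\<exists>N :: nat \<Rightarrow> 'c pmap list set.
    (\<forall>i\<in>{1..n}. N i \<lhd> \<F> L C \<and> finite (rcosets\<^bsub>\<F> L C\<^esub> (N i))) \<and>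
    HL_extension L C (Gamma L C n a N) (Gamma_embed L C n Cs a N) (Phi L C) \<and>
    finite (universe (Gamma L C n a N)) \<and>
    free_of L \<T> (Gamma L C n a N) \<and>
    HL_minimal L C (Gamma L C n a N) (Gamma_embed L C n Cs a N) (Phi L C) \<and>
    (\<exists>\<psi>. HL_hom L C (Gamma L C n a N) (Gamma_embed L C n Cs a N) (Phi L C) D e \<phi> \<psi> \<and>
         \<psi> ` universe (Gamma L C n a N) = universe D)"
proof -
  interpret HL_ext L C D e \<phi> by unfold_locales fact
  \<comment> \<open>The kernel of the action on \<open>D\<close> fulfils the normality assumption
    for every index, so all results on cosets apply to the constant family.\<close>
  interpret factorized_HL_ext L C D e \<phi> n Cs a
    by (intro factorized_HL_ext.intro factorized.intro HL_ext_axioms action_kernel_normal) fact+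
  show ?thesis
  proof (intro exI[of _ "\<lambda>_. action_kernel"] exI[of _ \<psi>] conjI ballI)
    show fin: "finite (rcosets\<^bsub>\<F> L C\<^esub> action_kernel)"
      by (rule finite_index_action_kernel) fact
    show "finite (universe \<Gamma>)" by (rule finite_Gamma) (rule fin)
    show "HL_extension L C \<Gamma> \<pi> (Phi L C)"
      by (rule Gamma_HL_extension) (rule Gamma_embed_is_embedding)
    show "free_of L \<T> \<Gamma>" by (rule Gamma_free_of) fact
    show "\<psi> ` universe \<Gamma> = universe D" by (rule psi_onto) fact
  qed (rule action_kernel_normal Gamma_minimal psi_HL_hom)+
qed

end
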